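(* Let $n\ge 2$. The metric dimension of the enhanced power graph $\mathcal{P}_e(SD_{8n})$ of the semidihedral group $SD_{8n}$ is $7n-4$.
   Context: For $n\ge 2$, the semidihedral group of order $8n$ is $SD_{8n}=\langle a,b : a^{4n}=b^2=e,\ ba=a^{2n-1}b\rangle$. The enhanced power graph $\mathcal{P}_e(G)$ of a finite group $G$ is the simple undirected graph with vertex set $G$ in which two distinct vertices $x,y$ are adjacent if and only if $x,y\in\langle z\rangle$ for some $z\in G$. In a connected graph $\Gamma$ with shortest-path distance $d$, a vertex $z$ resolves vertices $u,v$ if $d(z,u)\ne d(z,v)$. A set $U\subseteq V(\Gamma)$ is a resolving set if every pair of distinct vertices of $\Gamma$ is resolved by some vertex of $U$. The metric dimension $\dim(\Gamma)$ is the least cardinality of a resolving set of $\Gamma$. *)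

theory Defs
  imports
    "HOL-Algebra.Generated_Groups"
    "Graph_Theory.Pair_Digraph"
    "Graph_Theory.Shortest_Path"
begin

section \<open>Groups given by generators and relations\<close>

text \<open>The letter (g, True) stands for the generator g, and (g, False) for its formal inverse.\<close>

type_synonym 'g word = "('g \<times> bool) list"

text \<open>A pair (u, v) in R stands for the relation u = v. The relation below is the least congruence on
  words that contains R and identifies each product of a letter and its inverse with the empty word.\<close>

inductive pres_eq :: "('g word \<times> 'g word) set \<Rightarrow> 'g word \<Rightarrow> 'g word \<Rightarrow> bool"
  for R :: "('g word \<times> 'g word) set" where
  rel: "(u, v) \<in> R \<Longrightarrow> pres_eq R u v"
| cancel: "pres_eq R [(g, s), (g, \<not> s)] []"
| append: "pres_eq R u u' \<Longrightarrow> pres_eq R v v' \<Longrightarrow> pres_eq R (u @ v) (u' @ v')"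
| refl: "pres_eq R u u"
| sym: "pres_eq R u v \<Longrightarrow> pres_eq R v u"
| trans: "pres_eq R u v \<Longrightarrow> pres_eq R v w \<Longrightarrow> pres_eq R u w"

definition pres_class :: "('g word \<times> 'g word) set \<Rightarrow> 'g word \<Rightarrow> 'g word set" where
  "pres_class R u = {v. pres_eq R u v}"

text \<open>The generators are all elements of the type 'g.\<close>

definition presented_group :: "('g word \<times> 'g word) set \<Rightarrow> 'g word set monoid" where
  "presented_group R =
    \<lparr> carrier = range (pres_class R),
      monoid.mult = (\<lambda>X Y. \<Union>u\<in>X. \<Union>v\<in>Y. pres_class R (u @ v)),
      monoid.one = pres_class R [] \<rparr>"

lemma pres_class_eq_iff: "pres_class R u = pres_class R v \<longleftrightarrow> pres_eq R u v"
proof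
  assume "pres_class R u = pres_class R v"
  moreover have "v \<in> pres_class R v"
    by (simp add: pres_class_def pres_eq.refl)
  ultimately have "v \<in> pres_class R u"
    by (simp only:)
  then show "pres_eq R u v"
    by (simp add: pres_class_def)
next
  assume uv: "pres_eq R u v"
  have "pres_eq R u w \<longleftrightarrow> pres_eq R v w" for w
    using pres_eq.trans[OF uv, of w] pres_eq.trans[OF pres_eq.sym[OF uv], of w] by metis
  then show "pres_class R u = pres_class R v"
    by (simp add: pres_class_def)
qed

lemma presented_group_mult:
  "pres_class R u \<otimes>\<^bsub>presented_group R\<^esub> pres_class R v = pres_class R (u @ v)"
proof -
  have "pres_class R (u' @ v') = pres_class R (u @ v)"
    if "u' \<in> pres_class R u" "v' \<in> pres_class R v" for u' v'
  proof -
    have "pres_eq R u u'" "pres_eq R v v'"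
      using that by (simp_all add: pres_class_def)
    then show ?thesis
      by (simp only: pres_class_eq_iff pres_eq.sym[OF pres_eq.append])
  qed
  moreover have "u \<in> pres_class R u" "v \<in> pres_class R v"
    by (simp_all add: pres_class_def pres_eq.refl)
  ultimately have "(\<Union>u'\<in>pres_class R u. \<Union>v'\<in>pres_class R v. pres_class R (u' @ v'))
      = pres_class R (u @ v)"
    by blast
  then show ?thesis
    by (simp add: presented_group_def)
qed

lemma pres_eq_inverse_word: "pres_eq R (map (\<lambda>(g, s). (g, \<not> s)) (rev u) @ u) []"
proof (induction u)
  case (Cons x u)
  obtain g s where x: "x = (g, s)" by (cases x)
  let ?i = "\<lambda>w. map (\<lambda>(g, s). (g, \<not> s)) (rev w)"
  have c: "pres_eq R [(g, \<not> s), (g, s)] []"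
    using pres_eq.cancel[of R g "\<not> s"] by simp
  have "pres_eq R (?i u @ ([(g, \<not> s), (g, s)] @ u)) (?i u @ ([] @ u))"
    by (intro pres_eq.append pres_eq.refl c)
  then have "pres_eq R (?i (x # u) @ (x # u)) (?i u @ u)"
    by (simp add: x)
  then show ?case
    using Cons.IH by (rule pres_eq.trans)
qed (simp add: pres_eq.refl)

lemma group_presented_group: "group (presented_group R)"
proof (rule groupI)
  have carr: "carrier (presented_group R) = range (pres_class R)"
    and one: "\<one>\<^bsub>presented_group R\<^esub> = pres_class R []"
    by (simp_all add: presented_group_def)
  note [simp] = carr one presented_group_mult
  show "\<one>\<^bsub>presented_group R\<^esub> \<in> carrier (presented_group R)" by simp
  fix x assume x: "x \<in> carrier (presented_group R)"
  then obtain u where u: "x = pres_class R u" by auto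
  show "\<one>\<^bsub>presented_group R\<^esub> \<otimes>\<^bsub>presented_group R\<^esub> x = x" by (simp add: u)
  have "pres_class R (map (\<lambda>(g, s). (g, \<not> s)) (rev u)) \<otimes>\<^bsub>presented_group R\<^esub> x
      = \<one>\<^bsub>presented_group R\<^esub>"
    by (simp add: u pres_class_eq_iff pres_eq_inverse_word)
  then show "\<exists>y\<in>carrier (presented_group R). y \<otimes>\<^bsub>presented_group R\<^esub> x = \<one>\<^bsub>presented_group R\<^esub>"
    unfolding carr by blast
  fix y assume "y \<in> carrier (presented_group R)"
  then obtain v where v: "y = pres_class R v" by auto
  show "x \<otimes>\<^bsub>presented_group R\<^esub> y \<in> carrier (presented_group R)" by (simp add: u v)
  fix z assume "z \<in> carrier (presented_group R)"
  then obtain w where w: "z = pres_class R w" by auto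
  show "x \<otimes>\<^bsub>presented_group R\<^esub> y \<otimes>\<^bsub>presented_group R\<^esub> z
      = x \<otimes>\<^bsub>presented_group R\<^esub> (y \<otimes>\<^bsub>presented_group R\<^esub> z)"
    by (simp add: u v w)
qed

section \<open>The semidihedral group of order 8n\<close>

datatype sd_gen = Gen_a | Gen_b

definition semidihedral_relations :: "nat \<Rightarrow> (sd_gen word \<times> sd_gen word) set" where
  "semidihedral_relations n =
    (let a = (Gen_a, True); b = (Gen_b, True) in
      {(replicate (4 * n) a, []),
       (replicate 2 b, []),
       ([b, a], replicate (2 * n - 1) a @ [b])})"

definition semidihedral_group :: "nat \<Rightarrow> sd_gen word set monoid" where
  "semidihedral_group n = presented_group (semidihedral_relations n)"

section \<open>Enhanced power graphs\<close>

text \<open>An undirected edge is represented by the two opposite arcs.\<close>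

definition enhanced_power_graph :: "('a, 'm) monoid_scheme \<Rightarrow> 'a pair_pre_digraph" where
  "enhanced_power_graph G =
    \<lparr> pverts = carrier G,
      parcs = {(x, y). x \<in> carrier G \<and> y \<in> carrier G \<and> x \<noteq> y \<and>
        (\<exists>z\<in>carrier G. x \<in> generate G {z} \<and> y \<in> generate G {z})} \<rparr>"

lemma wf_enhanced_power_graph: "wf_digraph (with_proj (enhanced_power_graph G))"
  by unfold_locales (auto simp: enhanced_power_graph_def)

lemma sym_enhanced_power_graph: "symmetric (with_proj (enhanced_power_graph G))"
  by (auto simp: symmetric_def enhanced_power_graph_def intro: symI)

section \<open>Metric dimension\<close>

text \<open>With all weights equal to 1, the cost of a walk is its number of arcs. The distance is infinite
  between vertices that no walk joins; it is a natural number in a connected graph.\<close>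

definition graph_dist :: "'a pair_pre_digraph \<Rightarrow> 'a \<Rightarrow> 'a \<Rightarrow> ereal" where
  "graph_dist \<Gamma> u v = wf_digraph.\<mu> (with_proj \<Gamma>) (\<lambda>_. 1) u v"

definition resolves :: "'a pair_pre_digraph \<Rightarrow> 'a \<Rightarrow> 'a \<Rightarrow> 'a \<Rightarrow> bool" where
  "resolves \<Gamma> z u v \<longleftrightarrow> graph_dist \<Gamma> z u \<noteq> graph_dist \<Gamma> z v"

definition resolving_set :: "'a pair_pre_digraph \<Rightarrow> 'a set \<Rightarrow> bool" where
  "resolving_set \<Gamma> U \<longleftrightarrow> U \<subseteq> pverts \<Gamma> \<and>
    (\<forall>u\<in>pverts \<Gamma>. \<forall>v\<in>pverts \<Gamma>. u \<noteq> v \<longrightarrow> (\<exists>z\<in>U. resolves \<Gamma> z u v))"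

text \<open>The notion is meant for finite connected graphs, where the set of all vertices is resolving.\<close>

definition metric_dimension :: "'a pair_pre_digraph \<Rightarrow> nat" where
  "metric_dimension \<Gamma> = (LEAST k. \<exists>U. resolving_set \<Gamma> U \<and> finite U \<and> card U = k)"

end

theory Submission
  imports Defs "HOL-Algebra.Multiplicative_Group"
begin

text \<open>
  In the enhanced power graph of a group the identity is adjacent to every other vertex, so all
  distances are 0, 1 or 2 and are determined by adjacency. Call two vertices twins if no third vertex
  has an edge to exactly one of them. Twins can only be resolved by one of the two, so a resolving
  set misses at most one vertex of each class of mutual twins. Conversely, if one representative of
  each class can be dropped in such a way that the remaining vertices still tell the representatives
  apart, then the metric dimension is the order of the graph minus the number of classes; this is
  \<open>metric_dimension_eq_card_minus_twin_classes\<close>.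

  It remains to know the cyclic subgroups of the semidihedral group. The maximal ones are
  \<open>\<langle>a\<rangle>\<close> of order \<open>4 n\<close>, the groups \<open>{e, a\<^sup>i b}\<close> for the \<open>2 n\<close> even values of \<open>i\<close>, and the groups
  \<open>{e, a\<^sup>i b, a\<^sup>2\<^sup>n, a\<^sup>i\<^sup>+\<^sup>2\<^sup>n b}\<close> for the \<open>n\<close> pairs of odd exponents that differ by \<open>2 n\<close>
  (\<open>joined_coord_iff\<close>). The twin classes are therefore \<open>{e}\<close>, \<open>{a\<^sup>2\<^sup>n}\<close>, the rest of \<open>\<langle>a\<rangle>\<close>, the set of
  all \<open>a\<^sup>i b\<close> with \<open>i\<close> even, and the \<open>n\<close> pairs \<open>{a\<^sup>i b, a\<^sup>i\<^sup>+\<^sup>2\<^sup>n b}\<close> with \<open>i\<close> odd: there are \<open>n + 4\<close> of them,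
  and the dimension is \<open>8 n - (n + 4) = 7 n - 4\<close>.

  As the group is given by a presentation, its order is part of what has to be proved. The exponents
  \<open>(i, s)\<close> of a normal form \<open>a\<^sup>i b\<^sup>s\<close> are multiplied by an explicit rule that respects the defining
  relations, and this makes them coordinates on the group (\<open>bij_coord\<close>, \<open>coord_mult\<close>).
\<close>

section \<open>Metric dimension of a graph with a dominating vertex\<close>

locale dominated_graph =
  fixes \<Gamma> :: "'a pair_pre_digraph" and e :: 'a
  assumes finite_verts: "finite (pverts \<Gamma>)"
    and arcs_in_verts: "parcs \<Gamma> \<subseteq> pverts \<Gamma> \<times> pverts \<Gamma>"
    and centre: "e \<in> pverts \<Gamma>"
    and dominating: "x \<in> pverts \<Gamma> \<Longrightarrow> x \<noteq> e \<Longrightarrow> (x, e) \<in> parcs \<Gamma> \<and> (e, x) \<in> parcs \<Gamma>"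
begin

text \<open>A detour through the dominating vertex has length 2, so nothing is farther away than that.\<close>

lemma graph_dist_eq:
  assumes u: "u \<in> pverts \<Gamma>" and v: "v \<in> pverts \<Gamma>"
  shows "graph_dist \<Gamma> u v = (if u = v then 0 else if (u, v) \<in> parcs \<Gamma> then 1 else 2)"
proof -
  interpret wf_digraph "with_proj \<Gamma>"
    using arcs_in_verts by unfold_locales auto
  have cost: "awalk_cost (\<lambda>_. 1) p = real (length p)" for p :: "('a \<times> 'a) list"
    by (induction p) auto
  have le: "graph_dist \<Gamma> u v \<le> ereal (real (length p))" if "awalk u p v" for p
    using min_cost_le_walk_cost[OF that, of "\<lambda>_. 1"] by (simp add: graph_dist_def cost)
  have ge: "ereal (real k) \<le> graph_dist \<Gamma> u v" if "\<And>p. awalk u p v \<Longrightarrow> k \<le> length p" for k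
    unfolding graph_dist_def \<mu>_def using that by (intro INF_greatest) (simp add: cost)
  consider "u = v" | "u \<noteq> v" "(u, v) \<in> parcs \<Gamma>" | "u \<noteq> v" "(u, v) \<notin> parcs \<Gamma>"
    by blast
  then show ?thesis
  proof cases
    case 1
    then have "awalk u [] v"
      using u by (simp add: awalk_Nil_iff)
    from le[OF this] ge[of 0] 1 show ?thesis
      by (simp add: zero_ereal_def)
  next
    case 2
    have "awalk u [(u, v)] v"
      using 2 v by (simp add: awalk_simps)
    moreover have "1 \<le> length p" if "awalk u p v" for p
      using that 2 by (cases p) (auto simp: awalk_simps)
    ultimately show ?thesis
      using le[of "[(u, v)]"] ge[of 1] 2 by (simp add: one_ereal_def)
  next
    case 3
    have "(u, e) \<in> parcs \<Gamma>" "(e, v) \<in> parcs \<Gamma>"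
      using dominating[OF u] dominating[OF v] 3 by auto
    then have "awalk u [(u, e), (e, v)] v"
      using v by (simp add: awalk_simps)
    moreover have "2 \<le> length p" if "awalk u p v" for p
    proof (cases p)
      case Nil
      then show ?thesis using that 3 by (simp add: awalk_simps)
    next
      case (Cons x q)
      then show ?thesis using that 3 by (cases q) (auto simp: awalk_simps)
    qed
    ultimately show ?thesis
      using le[of "[(u, e), (e, v)]"] ge[of 2] 3 by (simp add: antisym)
  qed
qed

text \<open>The labelling \<open>c\<close> is constant only on sets of mutual twins, and \<open>W\<close> is a transversal of its fibres.
  Outside a resolving set \<open>c\<close> is injective, which is the lower bound. The complement of \<open>W\<close> is a
  resolving set of that size: a pair that is not contained in \<open>W\<close> is resolved by one of its own members,
  and for the other pairs a separating vertex outside \<open>W\<close> is assumed.\<close>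

theorem metric_dimension_eq_card_minus_twin_classes:
  fixes c :: "'a \<Rightarrow> 'b"
  assumes twins: "\<And>u v z. \<lbrakk>u \<in> pverts \<Gamma>; v \<in> pverts \<Gamma>; c u = c v; z \<in> pverts \<Gamma>; z \<noteq> u; z \<noteq> v\<rbrakk>
      \<Longrightarrow> (z, u) \<in> parcs \<Gamma> \<longleftrightarrow> (z, v) \<in> parcs \<Gamma>"
    and W: "W \<subseteq> pverts \<Gamma>" "bij_betw c W (c ` pverts \<Gamma>)"
    and separated: "\<And>u v. \<lbrakk>u \<in> W; v \<in> W; u \<noteq> v\<rbrakk>
      \<Longrightarrow> \<exists>z\<in>pverts \<Gamma> - W. ((z, u) \<in> parcs \<Gamma>) \<noteq> ((z, v) \<in> parcs \<Gamma>)"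
  shows "metric_dimension \<Gamma> = card (pverts \<Gamma>) - card W"
proof -
  let ?V = "pverts \<Gamma>"
  have finW: "finite W"
    using W(1) finite_verts by (rule finite_subset)
  have "resolving_set \<Gamma> (?V - W)"
    unfolding resolving_set_def
  proof (intro conjI ballI impI)
    fix u v assume uv: "u \<in> ?V" "v \<in> ?V" "u \<noteq> v"
    show "\<exists>z\<in>?V - W. resolves \<Gamma> z u v"
    proof (cases "u \<in> W \<and> v \<in> W")
      case True
      then obtain z where z: "z \<in> ?V - W" "((z, u) \<in> parcs \<Gamma>) \<noteq> ((z, v) \<in> parcs \<Gamma>)"
        using separated uv by blast
      moreover have "z \<noteq> u" "z \<noteq> v"
        using z True by auto
      ultimately show ?thesis
        using uv by (intro bexI[of _ z]) (auto simp: resolves_def graph_dist_eq)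
    next
      case False
      then obtain z where "z \<in> {u, v}" "z \<notin> W"
        by blast
      then show ?thesis
        using uv by (intro bexI[of _ z]) (auto simp: resolves_def graph_dist_eq split: if_splits)
    qed
  qed auto
  moreover have "card (?V - W) = card ?V - card W"
    using finW W(1) by (rule card_Diff_subset)
  moreover have "card ?V - card W \<le> card U" if U: "resolving_set \<Gamma> U" for U
  proof -
    have UV: "U \<subseteq> ?V"
      using U by (simp add: resolving_set_def)
    have "inj_on c (?V - U)"
    proof (rule inj_onI, rule ccontr)
      fix u v assume uv: "u \<in> ?V - U" "v \<in> ?V - U" "c u = c v" "u \<noteq> v"
      then obtain z where z: "z \<in> U" "resolves \<Gamma> z u v"
        using U unfolding resolving_set_def by blast
      then have "z \<in> ?V" "z \<noteq> u" "z \<noteq> v"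
        using uv UV by auto
      then show False
        using z uv twins[of u v z] by (simp add: resolves_def graph_dist_eq)
    qed
    then have "card (?V - U) \<le> card (c ` ?V)"
      by (metis card_image card_mono finite_imageI finite_verts image_mono Diff_subset)
    also have "\<dots> = card W"
      using W(2) by (simp add: bij_betw_same_card)
    finally have "card (?V - U) \<le> card W" .
    moreover have "card (?V - U) = card ?V - card U"
      using UV finite_verts by (meson card_Diff_subset finite_subset)
    ultimately show ?thesis
      by linarith
  qed
  ultimately show ?thesis
    unfolding metric_dimension_def using finite_verts
    by (intro Least_equality) (auto intro!: exI[of _ "?V - W"])
qed

end


section \<open>Normal forms in the semidihedral group\<close>

text \<open>The pair \<open>(i, s)\<close> stands for \<open>a\<^sup>i b\<^sup>s\<close>; moving \<open>b\<close> past \<open>a\<^sup>j\<close> multiplies the exponent \<open>j\<close> by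
  \<open>2 n - 1\<close>.\<close>

definition sd_mult :: "nat \<Rightarrow> nat \<times> bool \<Rightarrow> nat \<times> bool \<Rightarrow> nat \<times> bool" where
  "sd_mult n p q =
    ((fst p + (if snd p then (2 * n - 1) * fst q else fst q)) mod (4 * n), snd p \<noteq> snd q)"

text \<open>Conjugation by \<open>b\<close> has to be an involution on \<open>\<langle>a\<rangle>\<close>, and it is one because
  \<open>(2 n - 1)\<^sup>2 = 1 + 4 n (n - 1)\<close>.\<close>

lemma sd_twist_involution:
  fixes n k :: nat
  assumes "n > 0"
  shows "(2 * n - 1) * ((2 * n - 1) * k) mod (4 * n) = k mod (4 * n)"
proof -
  obtain m where m: "n = Suc m"
    using assms by (cases n) auto
  have "(2 * n - 1) * ((2 * n - 1) * k) = k + (4 * n) * (m * k)"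
    by (simp add: m algebra_simps)
  then show ?thesis
    by simp
qed

lemma sd_mult_assoc:
  assumes "n > 0"
  shows "sd_mult n (sd_mult n p q) r = sd_mult n p (sd_mult n q r)"
proof -
  define w where "w = 2 * n - 1"
  define N where "N = 4 * n"
  have w: "(w * (w * k)) mod N = k mod N" for k
    using sd_twist_involution[OF assms, of k] by (simp add: w_def N_def)
  have w': "(x + w * (y + w * k)) mod N = (x + w * y + k) mod N" for x y k
    by (metis (no_types, lifting) w add.assoc distrib_left mod_add_right_eq)
  have inner: "(x + w * (y mod N)) mod N = (x + w * y) mod N" for x y
    by (metis mod_add_right_eq mod_mult_right_eq)
  have mult: "sd_mult n p q =
      ((fst p + (if snd p then w * fst q else fst q)) mod N, snd p \<noteq> snd q)" for p q
    by (simp add: sd_mult_def w_def N_def)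
  show ?thesis
    by (cases "snd p"; cases "snd q")
      (simp_all add: mult mod_simps inner w' add.assoc, simp_all add: distrib_left add.assoc)
qed

definition letter_coord :: "nat \<Rightarrow> sd_gen \<times> bool \<Rightarrow> nat \<times> bool" where
  "letter_coord n x = (case x of
    (Gen_a, s) \<Rightarrow> (if s then 1 else 4 * n - 1, False) | (Gen_b, s) \<Rightarrow> (0, True))"

definition word_coord :: "nat \<Rightarrow> sd_gen word \<Rightarrow> nat \<times> bool" where
  "word_coord n u = foldr (\<lambda>x. sd_mult n (letter_coord n x)) u (0, False)"

lemma word_coord_simps:
  "word_coord n [] = (0, False)"
  "word_coord n (x # u) = sd_mult n (letter_coord n x) (word_coord n u)"
  by (simp_all add: word_coord_def)

lemma word_coord_less: "n > 0 \<Longrightarrow> fst (word_coord n u) < 4 * n"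
  by (cases u) (simp_all add: word_coord_simps sd_mult_def)

lemma word_coord_append:
  assumes "n > 0"
  shows "word_coord n (u @ v) = sd_mult n (word_coord n u) (word_coord n v)"
proof (induction u)
  case Nil
  show ?case
    using word_coord_less[OF assms, of v]
    by (auto simp: word_coord_simps sd_mult_def prod_eq_iff)
qed (simp add: word_coord_simps sd_mult_assoc[OF assms])

lemma word_coord_replicate_a:
  assumes "n > 0"
  shows "word_coord n (replicate k (Gen_a, True)) = (k mod (4 * n), False)"
  by (induction k) (simp_all add: word_coord_simps sd_mult_def letter_coord_def mod_Suc_eq)

text \<open>Words that represent the same group element have the same coordinates. It is this invariant that
  bounds the order of the group from below and excludes any collapse of the presentation.\<close>

lemma word_coord_sound:
  assumes n: "n > 0" and "pres_eq (semidihedral_relations n) u v"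
  shows "word_coord n u = word_coord n v"
  using assms(2)
proof induction
  case (rel u v)
  have *: "(2 * n - 1) mod (4 * n) = 2 * n - 1"
    using n by simp
  from rel show ?case
    using n
    by (auto simp: semidihedral_relations_def Let_def word_coord_append word_coord_replicate_a *)
      (auto simp: word_coord_simps sd_mult_def letter_coord_def numeral_2_eq_2)
next
  case (cancel g s)
  show ?case
    using n by (cases g; cases s) (auto simp: word_coord_simps sd_mult_def letter_coord_def)
qed (simp_all add: word_coord_append[OF n])

text \<open>The value on a class of words is the common value on its members, by \<open>word_coord_sound\<close>.\<close>

definition coord :: "nat \<Rightarrow> sd_gen word set \<Rightarrow> nat \<times> bool" where
  "coord n X = the_elem (word_coord n ` X)"

lemma coord_pres_class:
  assumes "n > 0"
  shows "coord n (pres_class (semidihedral_relations n) u) = word_coord n u"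
proof -
  have "word_coord n ` pres_class (semidihedral_relations n) u = {word_coord n u}"
    using word_coord_sound[OF assms, of u] pres_eq.refl by (auto simp: pres_class_def)
  then show ?thesis
    by (simp add: coord_def)
qed

section \<open>Coordinates of elements in a common cyclic subgroup\<close>

text \<open>The cyclic subgroup generated by \<open>a\<^sup>i b\<close>, in coordinates. Since \<open>(a\<^sup>i b)\<^sup>2 = a\<^sup>2\<^sup>n\<^sup>i\<close>, it has order 2 for
  even \<open>i\<close> and order 4 for odd \<open>i\<close>.\<close>

definition span_outside :: "nat \<Rightarrow> nat \<Rightarrow> (nat \<times> bool) set" where
  "span_outside n i = {(0, False), (i, True)} \<union>
    (if odd i then {(2 * n, False), ((i + 2 * n) mod (4 * n), True)} else {})"

text \<open>Membership in a common cyclic subgroup, in coordinates (see \<open>joined_coord_iff\<close>). The relation is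
  reflexive, unlike adjacency.\<close>

definition joined :: "nat \<Rightarrow> nat \<times> bool \<Rightarrow> nat \<times> bool \<Rightarrow> bool" where
  "joined n p q =
    (if snd p then
       if snd q then fst p = fst q \<or> odd (fst p) \<and> fst p mod (2 * n) = fst q mod (2 * n)
       else fst q = 0 \<or> odd (fst p) \<and> fst q = 2 * n
     else snd q \<longrightarrow> fst p = 0 \<or> odd (fst q) \<and> fst p = 2 * n)"

text \<open>A canonical element of each twin class: \<open>e\<close>, \<open>a\<^sup>2\<^sup>n\<close>, \<open>a\<close>, \<open>b\<close>, and \<open>a\<^sup>i b\<close> for odd \<open>i < 2 n\<close>.\<close>

definition twin_rep :: "nat \<Rightarrow> nat \<times> bool \<Rightarrow> nat \<times> bool" where
  "twin_rep n p =
    (if snd p then (if even (fst p) then 0 else fst p mod (2 * n), True)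
     else (if fst p \<in> {0, 2 * n} then fst p else 1, False))"

lemma mod_double_cases:
  fixes i j n :: nat
  assumes "i < 4 * n" "j < 4 * n" "i mod (2 * n) = j mod (2 * n)"
  shows "j = i \<or> j = (i + 2 * n) mod (4 * n)"
proof -
  have *: "k mod (2 * n) = (if k < 2 * n then k else k - 2 * n)" if "k < 4 * n" for k
    using that by (simp add: mod_if)
  have "(i + 2 * n) mod (4 * n) = (if i < 2 * n then i + 2 * n else i - 2 * n)"
    using assms(1) by (simp add: mod_if)
  with assms show ?thesis
    by (auto simp: * split: if_splits)
qed

lemma mod_mod_double: "(k mod (4 * n)) mod (2 * n) = k mod (2 * n)" for k n :: nat
  by (simp add: mod_mod_cancel)

lemma odd_mod_double: "odd (k mod (2 * n)) = odd k" for k n :: nat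
  by (simp add: dvd_mod_iff)

lemma joined_commute: "joined n p q \<longleftrightarrow> joined n q p"
  using odd_mod_double[of "fst p" n] odd_mod_double[of "fst q" n] by (auto simp: joined_def)

text \<open>The square of \<open>a\<^sup>i b\<close> is \<open>a\<^sup>2\<^sup>n\<^sup>i\<close>, which depends only on the parity of \<open>i\<close>.\<close>

lemma twist_double:
  fixes i n :: nat
  assumes "n > 0"
  shows "(i + (2 * n - 1) * i) mod (4 * n) = (if even i then 0 else 2 * n)"
proof -
  have "i + (2 * n - 1) * i = 2 * n * i"
    using assms by (cases n) (simp_all add: algebra_simps)
  moreover have "2 * n * i mod (2 * n * 2) = 2 * n * (i mod 2)"
    by (rule mult_mod_right[symmetric])
  ultimately show ?thesis
    by (auto simp: even_iff_mod_2_eq_zero odd_iff_mod_2_eq_one)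
qed

lemma sd_mult_span_outside:
  assumes "n > 0" "i < 4 * n" "p \<in> span_outside n i"
  shows "sd_mult n p (i, True) \<in> span_outside n i"
proof -
  have "((i + 2 * n) mod (4 * n) + (2 * n - 1) * i) mod (4 * n) = 0" if "odd i"
  proof -
    have "((i + 2 * n) mod (4 * n) + (2 * n - 1) * i) mod (4 * n)
        = (2 * n + (i + (2 * n - 1) * i) mod (4 * n)) mod (4 * n)"
      by (simp add: mod_simps add_ac)
    then show ?thesis
      using that twist_double[OF assms(1), of i] by simp
  qed
  then show ?thesis
    using assms twist_double[OF assms(1), of i]
    by (auto simp: span_outside_def sd_mult_def add.commute split: if_splits)
qed

lemma joined_span_outside:
  assumes "i < 4 * n" "p \<in> span_outside n i" "q \<in> span_outside n i"
  shows "joined n p q"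
  using assms odd_mod_double[of "(i + 2 * n) mod (4 * n)" n] odd_mod_double[of i n]
  by (auto simp: span_outside_def joined_def mod_mod_double split: if_splits)

lemma joined_imp_span_outside:
  assumes "joined n (i, True) q" "i < 4 * n" "fst q < 4 * n"
  shows "q \<in> span_outside n i"
  using assms mod_double_cases[of i n "fst q"]
  by (cases q) (auto simp: joined_def span_outside_def split: if_splits)

lemma joined_twins:
  assumes "twin_rep n p = twin_rep n q" "r \<noteq> p" "r \<noteq> q"
  shows "joined n r p \<longleftrightarrow> joined n r q"
  using assms odd_mod_double[of "fst p" n] odd_mod_double[of "fst q" n] odd_mod_double[of "fst r" n]
  by (cases p; cases q; cases r) (auto simp: twin_rep_def joined_def split: if_splits)

lemma twin_rep_idem: "n \<ge> 2 \<Longrightarrow> twin_rep n (twin_rep n p) = twin_rep n p"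
  using odd_mod_double[of "fst p" n] by (auto simp: twin_rep_def)

text \<open>The representatives are separated by elements that are not representatives themselves: \<open>a\<^sup>2\<close>
  distinguishes the inside of \<open>\<langle>a\<rangle>\<close> from the outside; \<open>a\<^sup>2 b\<close> is joined to \<open>e\<close> but not to \<open>a\<^sup>2\<^sup>n\<close> or \<open>a\<close>;
  \<open>a\<^sup>2\<^sup>n\<^sup>+\<^sup>1 b\<close> is joined to \<open>e\<close> and \<open>a\<^sup>2\<^sup>n\<close> but not to \<open>a\<close>; and for odd \<open>i < 2 n\<close> the twin
  \<open>a\<^sup>i\<^sup>+\<^sup>2\<^sup>n b\<close> is joined to \<open>a\<^sup>i b\<close> and to no other representative outside \<open>\<langle>a\<rangle>\<close>.\<close>

lemma twin_reps_separated:
  assumes n: "n \<ge> 2" and rep: "twin_rep n p = p" "twin_rep n q = q" "p \<noteq> q"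
  shows "\<exists>r. fst r < 4 * n \<and> twin_rep n r \<noteq> r \<and> joined n r p \<noteq> joined n r q"
proof -
  obtain i s j t where pq: "p = (i, s)" "q = (j, t)"
    by (cases p; cases q)
  consider (diff) "s \<noteq> t" | (inside) "\<not> s" "\<not> t" "i \<noteq> j" | (outside) s t "i \<noteq> j"
    using rep(3) pq by auto
  then show ?thesis
  proof cases
    case diff
    have "joined n (2, False) p \<noteq> joined n (2, False) q"
      using n diff by (auto simp: pq joined_def)
    then show ?thesis
      using n by (intro exI[of _ "(2, False)"]) (simp add: twin_rep_def)
  next
    case inside
    have "Suc (2 * n) mod (2 * n) = 1"
      using n mod_add_self1[of "2 * n" 1] by simp
    moreover have "joined n (2, True) p \<noteq> joined n (2, True) q \<or>
        joined n (2 * n + 1, True) p \<noteq> joined n (2 * n + 1, True) q"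
      using n inside rep by (auto simp: pq joined_def twin_rep_def split: if_splits)
    ultimately show ?thesis
      using n
      by (elim disjE) (intro exI[of _ "(2, True)"] exI[of _ "(2 * n + 1, True)"];
        simp add: twin_rep_def)+
  next
    case outside
    have sep: "joined n (k + 2 * n, True) (k, True) \<and> \<not> joined n (k + 2 * n, True) (l, True)"
      if "odd k" "k < 2 * n" "l < 2 * n" "k \<noteq> l" for k l
      using that by (auto simp: joined_def)
    have "k mod (2 * n) < 2 * n" for k
      using n by simp
    then have lt: "i < 2 * n" "j < 2 * n"
      using rep(1,2) outside n by (auto simp: pq twin_rep_def split: if_splits, metis+)
    have "odd i \<or> odd j"
      using rep outside by (auto simp: pq twin_rep_def split: if_splits)
    then show ?thesis
      using sep[of i j] sep[of j i] lt outside
      by (elim disjE) (intro exI[of _ "(i + 2 * n, True)"] exI[of _ "(j + 2 * n, True)"];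
        simp add: pq twin_rep_def)+
  qed
qed

lemma card_twin_reps:
  assumes n: "n \<ge> 2"
  shows "card {p \<in> {..<4 * n} \<times> UNIV. twin_rep n p = p} = n + 4"
proof -
  let ?odds = "(\<lambda>k. (2 * k + 1, True)) ` {..<n}"
  have "{p \<in> {..<4 * n} \<times> UNIV. twin_rep n p = p}
      = {(0, False), (2 * n, False), (1, False), (0, True)} \<union> ?odds" (is "?A = ?B")
  proof
    show "?B \<subseteq> ?A"
      using n by (auto simp: twin_rep_def)
    show "?A \<subseteq> ?B"
    proof
      fix p assume p: "p \<in> ?A"
      show "p \<in> ?B"
      proof (cases "snd p \<and> odd (fst p)")
        case True
        then have "fst p mod (2 * n) = fst p"
          using p by (auto simp: twin_rep_def prod_eq_iff)
        then have "fst p < 2 * n"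
          using n mod_less_divisor[of "2 * n" "fst p"] by simp
        then have "p = (\<lambda>k. (2 * k + 1, True)) (fst p div 2)" "fst p div 2 < n"
          using True by (auto simp: prod_eq_iff)
        then show ?thesis
          by blast
      next
        case False
        then show ?thesis
          using p by (cases p) (auto simp: twin_rep_def split: if_splits)
      qed
    qed
  qed
  moreover have "card ?odds = n"
    by (subst card_image) (auto simp: inj_on_def)
  moreover have "card {(0, False), (2 * n, False), (1, False), (0, True)} = 4"
    using n by (simp add: card_insert_if)
  moreover have "card ({(0, False), (2 * n, False), (1, False), (0, True)} \<union> ?odds)
      = card {(0, False), (2 * n, False), (1, False), (0, True)} + card ?odds"
    by (rule card_Un_disjoint) auto
  ultimately show ?thesis
    by simp
qed

section \<open>The semidihedral group in coordinates\<close>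

locale semidihedral =
  fixes n :: nat
  assumes n: "n \<ge> 2"
begin

abbreviation G where "G \<equiv> semidihedral_group n"
abbreviation cls where "cls \<equiv> pres_class (semidihedral_relations n)"

definition a where "a = cls [(Gen_a, True)]"
definition b where "b = cls [(Gen_b, True)]"

sublocale group G
  unfolding semidihedral_group_def by (rule group_presented_group)

lemma carrier_G: "carrier G = range cls"
  by (simp add: semidihedral_group_def presented_group_def)

lemma one_G: "\<one>\<^bsub>G\<^esub> = cls []"
  by (simp add: semidihedral_group_def presented_group_def)

lemma cls_append: "cls (u @ v) = cls u \<otimes>\<^bsub>G\<^esub> cls v"
  by (simp add: semidihedral_group_def presented_group_mult)

lemma cls_Cons: "cls (x # u) = cls [x] \<otimes>\<^bsub>G\<^esub> cls u"
  using cls_append[of "[x]" u] by simp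

lemma cls_closed [simp]: "cls u \<in> carrier G"
  by (simp add: carrier_G)

lemma a_closed [simp]: "a \<in> carrier G" and b_closed [simp]: "b \<in> carrier G"
  by (simp_all add: a_def b_def)

lemma cls_replicate: "cls (replicate k x) = cls [x] [^]\<^bsub>G\<^esub> k"
proof (induction k)
  case (Suc k)
  then show ?case
    by (simp only: replicate_Suc cls_Cons[of x "replicate k x"] nat_pow_Suc2[OF cls_closed])
qed (simp add: one_G)

lemma cls_rel: "(u, v) \<in> semidihedral_relations n \<Longrightarrow> cls u = cls v"
  by (simp add: pres_class_eq_iff pres_eq.rel)

lemma a_pow_order: "a [^]\<^bsub>G\<^esub> (4 * n) = \<one>\<^bsub>G\<^esub>"
  unfolding a_def cls_replicate[symmetric] one_G
  by (rule cls_rel) (simp add: semidihedral_relations_def Let_def)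

lemma b_square: "b \<otimes>\<^bsub>G\<^esub> b = \<one>\<^bsub>G\<^esub>"
  unfolding b_def cls_append[symmetric] one_G
  by (rule cls_rel) (simp add: semidihedral_relations_def Let_def numeral_2_eq_2)

lemma b_a: "b \<otimes>\<^bsub>G\<^esub> a = a [^]\<^bsub>G\<^esub> (2 * n - 1) \<otimes>\<^bsub>G\<^esub> b"
  unfolding a_def b_def cls_replicate[symmetric] cls_append[symmetric]
  by (rule cls_rel) (simp add: semidihedral_relations_def Let_def)

lemma a_pow_mod: "a [^]\<^bsub>G\<^esub> (k mod (4 * n)) = a [^]\<^bsub>G\<^esub> k"
proof -
  have "a [^]\<^bsub>G\<^esub> k = a [^]\<^bsub>G\<^esub> (4 * n * (k div (4 * n)) + k mod (4 * n))"
    by simp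
  also have "\<dots> = (a [^]\<^bsub>G\<^esub> (4 * n)) [^]\<^bsub>G\<^esub> (k div (4 * n)) \<otimes>\<^bsub>G\<^esub> a [^]\<^bsub>G\<^esub> (k mod (4 * n))"
    by (simp only: nat_pow_pow[OF a_closed] nat_pow_mult[OF a_closed])
  finally show ?thesis
    by (simp add: a_pow_order)
qed

lemma b_a_pow: "b \<otimes>\<^bsub>G\<^esub> a [^]\<^bsub>G\<^esub> k = a [^]\<^bsub>G\<^esub> ((2 * n - 1) * k) \<otimes>\<^bsub>G\<^esub> b"
proof (induction k)
  case (Suc k)
  have "b \<otimes>\<^bsub>G\<^esub> a [^]\<^bsub>G\<^esub> Suc k = (b \<otimes>\<^bsub>G\<^esub> a [^]\<^bsub>G\<^esub> k) \<otimes>\<^bsub>G\<^esub> a"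
    by (simp add: m_assoc)
  also have "\<dots> = a [^]\<^bsub>G\<^esub> ((2 * n - 1) * k) \<otimes>\<^bsub>G\<^esub> (b \<otimes>\<^bsub>G\<^esub> a)"
    by (simp only: Suc m_assoc a_closed b_closed nat_pow_closed)
  also have "\<dots> = (a [^]\<^bsub>G\<^esub> ((2 * n - 1) * k) \<otimes>\<^bsub>G\<^esub> a [^]\<^bsub>G\<^esub> (2 * n - 1)) \<otimes>\<^bsub>G\<^esub> b"
    by (simp only: b_a m_assoc a_closed b_closed nat_pow_closed)
  finally show ?case
    by (simp only: nat_pow_mult[OF a_closed] mult_Suc_right add.commute)
qed simp

definition elt :: "nat \<times> bool \<Rightarrow> sd_gen word set" where
  "elt p = a [^]\<^bsub>G\<^esub> fst p \<otimes>\<^bsub>G\<^esub> (if snd p then b else \<one>\<^bsub>G\<^esub>)"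

lemma elt_closed [simp]: "elt p \<in> carrier G"
  by (simp add: elt_def)

lemma elt_mult: "elt p \<otimes>\<^bsub>G\<^esub> elt q = elt (sd_mult n p q)"
proof -
  obtain i s j t where pq: "p = (i, s)" "q = (j, t)"
    by (cases p; cases q)
  let ?b = "if t then b else \<one>\<^bsub>G\<^esub>"
  show ?thesis
  proof (cases s)
    case False
    then show ?thesis
      by (simp add: pq elt_def sd_mult_def a_pow_mod nat_pow_mult[symmetric] m_assoc)
  next
    case True
    have "elt p \<otimes>\<^bsub>G\<^esub> elt q = a [^]\<^bsub>G\<^esub> i \<otimes>\<^bsub>G\<^esub> ((b \<otimes>\<^bsub>G\<^esub> a [^]\<^bsub>G\<^esub> j) \<otimes>\<^bsub>G\<^esub> ?b)"
      using True by (simp add: pq elt_def m_assoc)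
    also have "\<dots> = a [^]\<^bsub>G\<^esub> (i + (2 * n - 1) * j) \<otimes>\<^bsub>G\<^esub> (b \<otimes>\<^bsub>G\<^esub> ?b)"
      unfolding b_a_pow by (simp add: nat_pow_mult[symmetric] m_assoc)
    also have "\<dots> = elt (sd_mult n p q)"
      using True by (simp add: pq elt_def sd_mult_def a_pow_mod b_square)
    finally show ?thesis .
  qed
qed

lemma cls_inverse_letter: "cls [(g, False)] = inv\<^bsub>G\<^esub> cls [(g, True)]"
proof -
  have "cls [(g, False)] \<otimes>\<^bsub>G\<^esub> cls [(g, True)] = \<one>\<^bsub>G\<^esub>"
    using pres_eq.cancel[of "semidihedral_relations n" g False]
    by (simp add: one_G cls_append[symmetric] pres_class_eq_iff)
  then show ?thesis
    by (simp add: inv_equality)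
qed

lemma cls_letter: "cls [x] = elt (letter_coord n x)"
proof -
  have "a [^]\<^bsub>G\<^esub> (4 * n - 1) \<otimes>\<^bsub>G\<^esub> a = \<one>\<^bsub>G\<^esub>"
    using n a_pow_order by (simp add: nat_pow_Suc[symmetric] del: nat_pow_Suc)
  then have "inv\<^bsub>G\<^esub> a = a [^]\<^bsub>G\<^esub> (4 * n - 1)"
    by (simp add: inv_equality)
  moreover have "inv\<^bsub>G\<^esub> b = b"
    by (simp add: inv_equality b_square)
  moreover obtain g s where "x = (g, s)"
    by (cases x)
  ultimately show ?thesis
    by (cases g; cases s)
      (simp_all add: letter_coord_def elt_def a_def[symmetric] b_def[symmetric] cls_inverse_letter)
qed

text \<open>Every word can be brought to the normal form given by its coordinates. Together with
  \<open>word_coord_sound\<close> this makes the coordinates faithful.\<close>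

lemma cls_eq_elt: "cls u = elt (word_coord n u)"
proof (induction u)
  case Nil
  show ?case by (simp add: one_G[symmetric] word_coord_simps elt_def)
next
  case (Cons x u)
  have "cls (x # u) = cls [x] \<otimes>\<^bsub>G\<^esub> cls u"
    by (rule cls_Cons)
  then show ?case
    by (simp add: Cons cls_letter elt_mult word_coord_simps)
qed

definition coords :: "(nat \<times> bool) set" where
  "coords = {..<4 * n} \<times> UNIV"

lemma coord_cls: "coord n (cls u) = word_coord n u"
  using n by (simp add: coord_pres_class)

lemma coord_mult:
  assumes "x \<in> carrier G" "y \<in> carrier G"
  shows "coord n (x \<otimes>\<^bsub>G\<^esub> y) = sd_mult n (coord n x) (coord n y)"
proof -
  obtain u v where "x = cls u" "y = cls v"
    using assms by (auto simp: carrier_G)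
  then show ?thesis
    using n by (simp add: cls_append[symmetric] coord_cls word_coord_append)
qed

lemma coord_one: "coord n \<one>\<^bsub>G\<^esub> = (0, False)"
  by (simp add: one_G coord_cls word_coord_simps)

lemma bij_coord: "bij_betw (coord n) (carrier G) coords"
proof (rule bij_betw_imageI)
  show "inj_on (coord n) (carrier G)"
  proof (rule inj_onI)
    fix x y assume "x \<in> carrier G" "y \<in> carrier G" "coord n x = coord n y"
    moreover from this obtain u v where uv: "x = cls u" "y = cls v"
      by (auto simp: carrier_G)
    ultimately have "word_coord n u = word_coord n v"
      by (simp only: coord_cls)
    then show "x = y"
      unfolding uv by (simp only: cls_eq_elt)
  qed
  have "coord n (cls u) \<in> coords" for u
    using word_coord_less[of n u] n by (simp add: coord_cls coords_def mem_Times_iff)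
  moreover have "p \<in> coord n ` carrier G" if p: "p \<in> coords" for p
  proof -
    let ?u = "replicate (fst p) (Gen_a, True) @ (if snd p then [(Gen_b, True)] else [])"
    have "word_coord n ?u = p"
      using n p
      by (auto simp: word_coord_append word_coord_replicate_a word_coord_simps coords_def
          sd_mult_def letter_coord_def)
    then have "coord n (cls ?u) = p"
      by (simp add: coord_cls)
    then show ?thesis
      by (metis cls_closed image_eqI)
  qed
  ultimately show "coord n ` carrier G = coords"
    by (auto simp: carrier_G)
qed

lemma finite_G: "finite (carrier G)"
  using bij_betw_finite[OF bij_coord] by (simp add: coords_def)

lemma card_G: "card (carrier G) = 8 * n"
  using bij_betw_same_card[OF bij_coord] by (simp add: coords_def card_cartesian_product)


section \<open>Cyclic subgroups\<close>

lemma coord_inj: "x \<in> carrier G \<Longrightarrow> y \<in> carrier G \<Longrightarrow> coord n x = coord n y \<longleftrightarrow> x = y"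
  using bij_coord by (auto simp: bij_betw_def inj_on_def)

lemma coord_in: "x \<in> carrier G \<Longrightarrow> coord n x \<in> coords"
  using bij_coord by (auto simp: bij_betw_def)

lemma coord_less: "x \<in> carrier G \<Longrightarrow> fst (coord n x) < 4 * n"
  using coord_in by (auto simp: coords_def mem_Times_iff)

lemma coord_surj: "p \<in> coords \<Longrightarrow> \<exists>x\<in>carrier G. coord n x = p"
  by (metis bij_coord bij_betw_imp_surj_on imageE)

lemma coord_pow_outside:
  assumes z: "z \<in> carrier G" "coord n z = (i, True)"
  shows "coord n (z [^]\<^bsub>G\<^esub> (k::nat)) \<in> span_outside n i"
proof (induction k)
  case 0
  show ?case by (simp add: coord_one span_outside_def)
next
  case (Suc k)
  have "sd_mult n p (i, True) \<in> span_outside n i" if "p \<in> span_outside n i" for p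
    using that sd_mult_span_outside[of n i] coord_in[OF z(1)] n z(2) by (simp add: coords_def)
  then show ?case
    using Suc z by (simp add: coord_mult)
qed

lemma generate_iff:
  assumes "x \<in> carrier G" "z \<in> carrier G"
  shows "x \<in> generate G {z} \<longleftrightarrow> (\<exists>k::nat. coord n x = coord n (z [^]\<^bsub>G\<^esub> k))"
  using assms by (auto simp: generate_pow_on_finite_carrier[OF finite_G] coord_inj)

lemma generate_outside:
  assumes "x \<in> carrier G" "z \<in> carrier G" "coord n z = (i, True)"
  shows "x \<in> generate G {z} \<longleftrightarrow> coord n x \<in> span_outside n i"
proof
  assume "x \<in> generate G {z}"
  then show "coord n x \<in> span_outside n i"
    using assms coord_pow_outside by (auto simp: generate_iff)
next
  assume x: "coord n x \<in> span_outside n i"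
  have 0: "coord n (z [^]\<^bsub>G\<^esub> (0::nat)) = (0, False)"
    by (simp add: coord_one)
  have 1: "coord n (z [^]\<^bsub>G\<^esub> (1::nat)) = (i, True)"
    using assms by simp
  have 2: "coord n (z [^]\<^bsub>G\<^esub> (2::nat)) = (2 * n, False)" if "odd i"
  proof -
    have "z [^]\<^bsub>G\<^esub> (2::nat) = z \<otimes>\<^bsub>G\<^esub> z"
      using assms by (simp add: numeral_2_eq_2)
    then show ?thesis
      using assms that n twist_double[of n i] by (simp add: coord_mult sd_mult_def)
  qed
  have 3: "coord n (z [^]\<^bsub>G\<^esub> (3::nat)) = ((i + 2 * n) mod (4 * n), True)" if "odd i"
  proof -
    have "z [^]\<^bsub>G\<^esub> (3::nat) = z [^]\<^bsub>G\<^esub> (2::nat) \<otimes>\<^bsub>G\<^esub> z"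
      by (simp add: numeral_3_eq_3 numeral_2_eq_2)
    then show ?thesis
      using assms 2[OF that] by (simp add: coord_mult sd_mult_def add.commute)
  qed
  consider "coord n x = (0, False)" | "coord n x = (i, True)"
    | "odd i" "coord n x = (2 * n, False)"
    | "odd i" "coord n x = ((i + 2 * n) mod (4 * n), True)"
    using x by (auto simp: span_outside_def split: if_splits)
  then have "\<exists>k::nat. coord n x = coord n (z [^]\<^bsub>G\<^esub> k)"
    using 0 1 2 3 by cases metis+
  then show "x \<in> generate G {z}"
    using assms by (simp add: generate_iff)
qed

lemma generate_inside:
  assumes "x \<in> carrier G" "z \<in> carrier G" "\<not> snd (coord n z)" "x \<in> generate G {z}"
  shows "\<not> snd (coord n x)"
proof -
  have "\<not> snd (coord n (z [^]\<^bsub>G\<^esub> k))" for k :: nat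
    using assms by (induction k) (simp_all add: coord_one coord_mult sd_mult_def)
  then show ?thesis
    using assms generate_iff by auto
qed

lemma generate_rotation:
  assumes "x \<in> carrier G" "z \<in> carrier G" "coord n z = (1, False)" "\<not> snd (coord n x)"
  shows "x \<in> generate G {z}"
proof -
  have "coord n (z [^]\<^bsub>G\<^esub> k) = (k mod (4 * n), False)" for k :: nat
    using assms by (induction k) (simp_all add: coord_one coord_mult sd_mult_def mod_Suc_eq)
  then have "coord n x = coord n (z [^]\<^bsub>G\<^esub> fst (coord n x))"
    using coord_in[OF assms(1)] assms(4) by (simp add: coords_def mem_Times_iff prod_eq_iff)
  then show ?thesis
    using assms generate_iff by blast
qed

text \<open>A cyclic subgroup has a generator inside \<open>\<langle>a\<rangle>\<close> and then lies in \<open>\<langle>a\<rangle>\<close>, or it is generated by some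
  \<open>a\<^sup>i b\<close>. Conversely, if one of two joined elements lies outside \<open>\<langle>a\<rangle>\<close>, then it already generates the
  other.\<close>

lemma joined_coord_iff:
  assumes x: "x \<in> carrier G" and y: "y \<in> carrier G"
  shows "(\<exists>z\<in>carrier G. x \<in> generate G {z} \<and> y \<in> generate G {z})
    \<longleftrightarrow> joined n (coord n x) (coord n y)" (is "?L \<longleftrightarrow> ?R")
proof
  assume ?L
  then obtain z where z: "z \<in> carrier G" "x \<in> generate G {z}" "y \<in> generate G {z}"
    by blast
  show ?R
  proof (cases "snd (coord n z)")
    case True
    then obtain i where i: "coord n z = (i, True)"
      by (metis prod.collapse)
    then have "i < 4 * n"
      using coord_in[OF z(1)] by (simp add: coords_def)
    moreover have "coord n x \<in> span_outside n i" "coord n y \<in> span_outside n i"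
      using generate_outside[OF _ z(1) i] x y z by simp_all
    ultimately show ?thesis
      by (rule joined_span_outside)
  next
    case False
    then show ?thesis
      using generate_inside[OF _ z(1)] x y z by (simp add: joined_def)
  qed
next
  assume R: ?R
  consider "\<not> snd (coord n x)" "\<not> snd (coord n y)" | "snd (coord n x)" | "snd (coord n y)"
    by blast
  then show ?L
  proof cases
    case 1
    obtain z where "z \<in> carrier G" "coord n z = (1, False)"
      using coord_surj[of "(1, False)"] n by (auto simp: coords_def)
    then show ?thesis
      using generate_rotation 1 x y by blast
  next
    case 2
    then have c: "coord n x = (fst (coord n x), True)"
      by (simp add: prod_eq_iff)
    have "coord n y \<in> span_outside n (fst (coord n x))"
      using R c coord_less[OF x] coord_less[OF y] by (intro joined_imp_span_outside) auto
    then have "y \<in> generate G {x}"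
      by (simp add: generate_outside[OF y x c])
    moreover have "x \<in> generate G {x}"
      by (simp add: generate.incl)
    ultimately show ?thesis
      using x by blast
  next
    case 3
    then have c: "coord n y = (fst (coord n y), True)"
      by (simp add: prod_eq_iff)
    have "joined n (coord n y) (coord n x)"
      using R by (simp add: joined_commute)
    then have "coord n x \<in> span_outside n (fst (coord n y))"
      using c coord_less[OF x] coord_less[OF y] by (intro joined_imp_span_outside) auto
    then have "x \<in> generate G {y}"
      by (simp add: generate_outside[OF x y c])
    moreover have "y \<in> generate G {y}"
      by (simp add: generate.incl)
    ultimately show ?thesis
      using y by blast
  qed
qed

section \<open>Twin classes of the enhanced power graph\<close>

abbreviation \<Gamma> where "\<Gamma> \<equiv> enhanced_power_graph G"

lemma pverts_\<Gamma>: "pverts \<Gamma> = carrier G"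
  by (simp add: enhanced_power_graph_def)

lemma parcs_\<Gamma>_iff:
  "(x, y) \<in> parcs \<Gamma> \<longleftrightarrow>
    x \<in> carrier G \<and> y \<in> carrier G \<and> x \<noteq> y \<and> joined n (coord n x) (coord n y)"
  using joined_coord_iff[of x y] by (auto simp: enhanced_power_graph_def)

sublocale dominated_graph \<Gamma> "\<one>\<^bsub>G\<^esub>"
proof
  show "finite (pverts \<Gamma>)" "\<one>\<^bsub>G\<^esub> \<in> pverts \<Gamma>"
    by (simp_all add: pverts_\<Gamma> finite_G)
  show "parcs \<Gamma> \<subseteq> pverts \<Gamma> \<times> pverts \<Gamma>"
    by (auto simp: parcs_\<Gamma>_iff pverts_\<Gamma>)
  show "(x, \<one>\<^bsub>G\<^esub>) \<in> parcs \<Gamma> \<and> (\<one>\<^bsub>G\<^esub>, x) \<in> parcs \<Gamma>" if "x \<in> pverts \<Gamma>" "x \<noteq> \<one>\<^bsub>G\<^esub>" for x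
    using that by (auto simp: parcs_\<Gamma>_iff pverts_\<Gamma> coord_one joined_def)
qed

theorem metric_dimension_\<Gamma>: "metric_dimension \<Gamma> = 7 * n - 4"
proof -
  let ?c = "\<lambda>x. twin_rep n (coord n x)"
  let ?W = "{x \<in> carrier G. ?c x = coord n x}"
  have rep_in: "twin_rep n p \<in> coords" if "p \<in> coords" for p
    using n that le_less_trans[OF mod_less_eq_dividend, of "fst p" "4 * n" "2 * n"]
    by (auto simp: coords_def twin_rep_def mem_Times_iff)
  have idem: "twin_rep n (twin_rep n p) = twin_rep n p" for p
    using n by (rule twin_rep_idem)
  have "metric_dimension \<Gamma> = card (pverts \<Gamma>) - card ?W"
  proof (rule metric_dimension_eq_card_minus_twin_classes)
    fix u v z
    assume "u \<in> pverts \<Gamma>" "v \<in> pverts \<Gamma>" "?c u = ?c v" "z \<in> pverts \<Gamma>" "z \<noteq> u" "z \<noteq> v"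
    then show "(z, u) \<in> parcs \<Gamma> \<longleftrightarrow> (z, v) \<in> parcs \<Gamma>"
      using joined_twins[of n "coord n u" "coord n v" "coord n z"]
      by (auto simp: parcs_\<Gamma>_iff pverts_\<Gamma> coord_inj)
  next
    show "?W \<subseteq> pverts \<Gamma>"
      by (auto simp: pverts_\<Gamma>)
    have "inj_on ?c ?W"
      by (rule inj_onI) (auto simp: coord_inj)
    moreover have "?c x \<in> ?c ` ?W" if x: "x \<in> carrier G" for x
    proof -
      obtain y where "y \<in> carrier G" "coord n y = ?c x"
        using coord_surj[OF rep_in[OF coord_in[OF x]]] by blast
      then show ?thesis
        by (intro image_eqI[of _ _ y]) (simp_all add: idem)
    qed
    ultimately show "bij_betw ?c ?W (?c ` pverts \<Gamma>)"
      unfolding bij_betw_def pverts_\<Gamma> by blast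
  next
    fix u v assume uv: "u \<in> ?W" "v \<in> ?W" "u \<noteq> v"
    then have "coord n u \<noteq> coord n v"
      by (auto simp: coord_inj)
    moreover have "twin_rep n (coord n u) = coord n u" "twin_rep n (coord n v) = coord n v"
      using uv by simp_all
    ultimately obtain r where r: "fst r < 4 * n" "twin_rep n r \<noteq> r"
        "joined n r (coord n u) \<noteq> joined n r (coord n v)"
      using twin_reps_separated[OF n] by blast
    then obtain z where z: "z \<in> carrier G" "coord n z = r"
      using coord_surj[of r] by (auto simp: coords_def mem_Times_iff)
    show "\<exists>z\<in>pverts \<Gamma> - ?W. ((z, u) \<in> parcs \<Gamma>) \<noteq> ((z, v) \<in> parcs \<Gamma>)"
      using z r uv by (intro bexI[of _ z]) (auto simp: parcs_\<Gamma>_iff pverts_\<Gamma>)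
  qed
  moreover have "card ?W = n + 4"
  proof -
    have "coord n ` ?W = {p \<in> coord n ` carrier G. twin_rep n p = p}"
      by blast
    also have "\<dots> = {p \<in> coords. twin_rep n p = p}"
      using bij_coord by (simp add: bij_betw_def)
    finally have "coord n ` ?W = {p \<in> coords. twin_rep n p = p}" .
    moreover have "card (coord n ` ?W) = card ?W"
      by (rule card_image, rule inj_onI) (auto simp: coord_inj)
    ultimately have "card ?W = card {p \<in> coords. twin_rep n p = p}"
      by simp
    then show ?thesis
      using card_twin_reps[OF n] by (simp add: coords_def)
  qed
  ultimately show ?thesis
    by (simp add: pverts_\<Gamma> card_G)
qed

end

theorem proposition3p12:
  fixes n :: nat
  assumes "n \<ge> 2"
  shows "metric_dimension (enhanced_power_graph (semidihedral_group n)) = 7 * n - 4"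
proof -
  interpret semidihedral n
    using assms by unfold_locales
  show ?thesis
    by (rule metric_dimension_\<Gamma>)
qed

end
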